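(* Let $q$ be a prime power with $q\equiv 1\pmod 3$ and let $n\geq 2$ be an integer. Let $\omega\in\mathbb{F}_{q^{2n}}\setminus\mathbb{F}_{q^n}$, let $a\in\mathbb{F}_{q^{3n}}^*$ and let $i$ be an integer with $1\leq i\leq 3n-1$ such that (I) $\gcd(i,2n)=\gcd(i,3n)=1$, and (II) $\big(N_{q^{3n}/q}(a)\big)^{\frac{q-1}{3}}\neq 1$. Then $$L_U=\{\langle ax^{q^i}+x\omega\rangle_{\mathbb{F}_{q^{2n}}} : x\in\mathbb{F}_{q^{3n}}^*\},\qquad U=\{ax^{q^i}+x\omega: x\in\mathbb{F}_{q^{3n}}\},$$ is a scattered $\mathbb{F}_q$-linear set of rank $3n$ of the projective plane $PG(2,q^{2n})=PG(\mathbb{F}_{q^{6n}},\mathbb{F}_{q^{2n}})$.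
   Context: $N_{q^{3n}/q}$ denotes the norm map from $\mathbb{F}_{q^{3n}}$ to $\mathbb{F}_{q}$. $\mathbb{F}_{q^{6n}}$ is regarded as a $3$-dimensional vector space over $\mathbb{F}_{q^{2n}}$. For an $\mathbb{F}_q$-subspace $U$ of $\mathbb{F}_{q^{6n}}$ of $\mathbb{F}_q$-dimension $k$, $L_U=\{\langle u\rangle_{\mathbb{F}_{q^{2n}}}: u\in U\setminus\{0\}\}$ is an $\mathbb{F}_q$-linear set of rank $k$; it is scattered if every point $\langle v\rangle$ of $L_U$ satisfies $\dim_{\mathbb{F}_q}(U\cap\langle v\rangle_{\mathbb{F}_{q^{2n}}})=1$. *)

theory Defs
  imports "HOL-Algebra.Algebra" "HOL-Number_Theory.Number_Theory"
begin

text \<open>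
  Vector spaces over a subfield \<open>k\<close> of a field \<open>F\<close> are rendered with the library's notions for
  embedded algebras: despite its name, \<^const>\<open>subalgebra\<close> \<open>k U F\<close> says exactly that \<open>U\<close> is a
  \<open>k\<close>-subspace of \<open>F\<close>; \<open>ring.dimension F d k U\<close> says that \<open>U\<close> has \<open>k\<close>-dimension \<open>d\<close>, and
  \<open>ring.Span F K [v]\<close> is the \<open>K\<close>-subspace generated by \<open>v\<close>.
\<close>

text \<open>The points of the projective space \<open>PG(F, K)\<close>.\<close>

definition PG_points :: "('a, 'b) ring_scheme \<Rightarrow> 'a set \<Rightarrow> 'a set set" where
  "PG_points F K = {ring.Span F K [v] | v. v \<in> carrier F - {\<zero>\<^bsub>F\<^esub>}}"

definition linear_set :: "('a, 'b) ring_scheme \<Rightarrow> 'a set \<Rightarrow> 'a set \<Rightarrow> 'a set set" where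
  "linear_set F K U = {ring.Span F K [u] | u. u \<in> U - {\<zero>\<^bsub>F\<^esub>}}"

text \<open>\<open>L\<close> is the \<open>k\<close>-linear set of \<open>PG(F, K)\<close> of rank \<open>r\<close> defined by \<open>U\<close>. Rank and scatteredness
  are properties of a linear set together with its defining subspace \<open>U\<close>.\<close>

definition linear_set_of_rank ::
    "('a, 'b) ring_scheme \<Rightarrow> 'a set \<Rightarrow> 'a set \<Rightarrow> nat \<Rightarrow> 'a set \<Rightarrow> 'a set set \<Rightarrow> bool" where
  "linear_set_of_rank F k K r U L \<longleftrightarrow>
     subalgebra k U F \<and> ring.dimension F r k U \<and> L = linear_set F K U \<and> L \<subseteq> PG_points F K"

definition scattered_linear_set ::
    "('a, 'b) ring_scheme \<Rightarrow> 'a set \<Rightarrow> 'a set \<Rightarrow> 'a set \<Rightarrow> bool" where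
  "scattered_linear_set F k K U \<longleftrightarrow>
     (\<forall>P \<in> linear_set F K U. ring.dimension F 1 k (U \<inter> P))"

text \<open>The norm from the field of order \<open>q ^ m\<close> to its subfield of order \<open>q\<close>, as the product of the
  conjugates of \<open>a\<close>; meaningful when \<open>a\<close> lies in the subfield of \<open>F\<close> of order \<open>q ^ m\<close>.\<close>

definition finite_field_norm :: "('a, 'b) ring_scheme \<Rightarrow> nat \<Rightarrow> nat \<Rightarrow> 'a \<Rightarrow> 'a" where
  "finite_field_norm F q m a = (\<Otimes>\<^bsub>F\<^esub>j\<in>{..<m}. a [^]\<^bsub>F\<^esub> (q ^ j))"

end

theory Submission
  imports Defs
begin

text \<open>
  Put \<open>P = q ^ n\<close>, \<open>Q = q ^ i\<close>, \<open>E = (P ^ 3 - 1) / 3\<close>, so that \<open>N(a) ^ ((q - 1) / 3) = a ^ E\<close>. If two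
  vectors \<open>a x ^ Q + x \<omega>\<close> and \<open>a y ^ Q + y \<omega>\<close> differ by a factor \<open>\<alpha> + \<beta> \<omega>\<close> with \<open>\<alpha>, \<beta>\<close> in the field of
  order \<open>P\<close> and \<open>\<beta> \<noteq> 0\<close>, comparing coordinates with respect to \<open>1, \<omega>\<close> shows that the span \<open>V\<close> of \<open>x\<close>
  and \<open>w = a x ^ Q\<close> over that field is invariant under the semilinear map \<open>z \<mapsto> a z ^ Q\<close>.
  If \<open>V\<close> is a line, \<open>a x ^ (Q - 1)\<close> lies in the field of order \<open>P\<close>, and \<open>a ^ E = 1\<close> follows.
  Otherwise \<open>c = w ^ P x ^ (P ^ 2) - x ^ P w ^ (P ^ 2)\<close> is nonzero, and as an alternating form it is
  multiplied by the determinant under the map, so \<open>a ^ (P + P ^ 2) c ^ (Q - 1)\<close> lies in the field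
  of order \<open>P\<close>. Then \<open>a ^ (2 E) = 1 = a ^ (3 E)\<close>, hence again \<open>a ^ E = 1\<close>. So \<open>\<beta> = 0\<close>, and \<open>\<alpha>\<close> is
  fixed by the coprime Frobenius powers \<open>Q\<close> and \<open>P\<close>.
\<close>

section \<open>Additivity of Frobenius powers in a finite domain\<close>

lemma (in cring) binomial_expansion:
  assumes x: "x \<in> carrier R" and y: "y \<in> carrier R"
  shows "(x \<oplus> y) [^] (m::nat) = (\<Oplus>k\<in>{..m}. [(m choose k)] \<cdot> (x [^] k \<otimes> y [^] (m - k)))"
proof (induction m)
  case 0
  show ?case using x y by simp
next
  case (Suc m)
  let ?t = "\<lambda>k. [(m choose k)] \<cdot> (x [^] k \<otimes> y [^] (m - k))"
  let ?A = "\<lambda>k. [(m choose k)] \<cdot> (x [^] Suc k \<otimes> y [^] (m - k))"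
  let ?B = "\<lambda>k. [(m choose k)] \<cdot> (x [^] k \<otimes> y [^] (Suc m - k))"
  have tx: "?t k \<otimes> x = ?A k" for k
    using x y by (simp add: add_pow_ldistr add_pow_rdistr m_ac)
  have ty: "?t k \<otimes> y = ?B k" if "k \<le> m" for k
    using x y that by (simp add: add_pow_ldistr add_pow_rdistr m_ac Suc_diff_le)
  have "(x \<oplus> y) [^] Suc m = (\<Oplus>k\<in>{..m}. ?t k) \<otimes> (x \<oplus> y)"
    using Suc by simp
  also have "\<dots> = (\<Oplus>k\<in>{..m}. ?t k) \<otimes> x \<oplus> (\<Oplus>k\<in>{..m}. ?t k) \<otimes> y"
    using x y by (intro r_distr) auto
  also have "(\<Oplus>k\<in>{..m}. ?t k) \<otimes> x = (\<Oplus>k\<in>{..m}. ?A k)"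
    unfolding tx[symmetric] using x y by (intro finsum_ldistr) auto
  also have "(\<Oplus>k\<in>{..m}. ?t k) \<otimes> y = (\<Oplus>k\<in>{..m}. ?t k \<otimes> y)"
    using x y by (intro finsum_ldistr) auto
  also have "\<dots> = (\<Oplus>k\<in>{..m}. ?B k)"
    using x y ty by (intro finsum_cong') auto
  also have "\<dots> = (\<Oplus>k\<in>{..Suc m}. ?B k)"
    using x y by (subst finsum_Suc) (auto simp: binomial_eq_0)
  also have "\<dots> = (\<Oplus>k\<in>{..m}. ?B (Suc k)) \<oplus> ?B 0"
    using x y by (intro finsum_Suc2) auto
  also have "(\<Oplus>k\<in>{..m}. ?A k) \<oplus> ((\<Oplus>k\<in>{..m}. ?B (Suc k)) \<oplus> ?B 0)
      = (\<Oplus>k\<in>{..m}. ?A k \<oplus> ?B (Suc k)) \<oplus> ?B 0"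
    using x y by (subst finsum_addf) (auto simp: a_assoc simp del: nat_pow_Suc diff_Suc_Suc binomial_n_0)
  also have "(\<Oplus>k\<in>{..m}. ?A k \<oplus> ?B (Suc k))
      = (\<Oplus>k\<in>{..m}. [(Suc m choose Suc k)] \<cdot> (x [^] Suc k \<otimes> y [^] (Suc m - Suc k)))"
    using x y by (intro finsum_cong') (auto simp: add.nat_pow_mult)
  also have "\<dots> \<oplus> ?B 0 = (\<Oplus>k\<in>{..Suc m}. [(Suc m choose k)] \<cdot> (x [^] k \<otimes> y [^] (Suc m - k)))"
    using x y by (subst finsum_Suc2) auto
  finally show ?case .
qed

lemma (in domain) nat_pow_nonzero:
  assumes "x \<in> carrier R" "x \<noteq> \<zero>"
  shows "x [^] (m::nat) \<noteq> \<zero>"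
  using assms by (induction m) (auto simp: integral_iff)

text \<open>The order \<open>p ^ M\<close> of the additive group annihilates \<open>\<one>\<close>,
  and \<open>[(p ^ k)] \<cdot> \<one>\<close> is the \<open>k\<close>-th power of
  \<open>[p] \<cdot> \<one>\<close>. That element is thus nilpotent, hence zero in a domain.\<close>

lemma (in domain) add_pow_base_eq_zero:
  assumes "card (carrier R) = p ^ M" and x: "x \<in> carrier R"
  shows "[(p::nat)] \<cdot> x = \<zero>"
proof -
  have "[(p ^ M)] \<cdot> \<one> = \<zero>"
    using add.pow_order_eq_1[OF one_closed] assms(1) by (simp add: order_def)
  moreover have "[(p ^ k)] \<cdot> \<one> = ([p] \<cdot> \<one>) [^] k" for k
  proof (induction k)
    case (Suc k)
    have "[(p ^ Suc k)] \<cdot> \<one> = [p] \<cdot> ([(p ^ k)] \<cdot> \<one>)"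
      by (simp add: add.nat_pow_pow mult.commute)
    also have "\<dots> = ([p] \<cdot> \<one>) [^] Suc k"
      unfolding Suc by (simp add: add_pow_rdistr)
    finally show ?case .
  qed simp
  ultimately have "([p] \<cdot> \<one>) [^] M = \<zero>"
    by simp
  then have "[p] \<cdot> \<one> = \<zero>"
    using nat_pow_nonzero by (metis add.nat_pow_closed one_closed)
  then show ?thesis
    using add_pow_ldistr[OF one_closed x, of p] x by simp
qed

lemma (in domain) prime_pow_add:
  assumes p: "Factorial_Ring.prime (p::nat)" and card: "card (carrier R) = p ^ M"
    and x: "x \<in> carrier R" and y: "y \<in> carrier R"
  shows "(x \<oplus> y) [^] p = x [^] p \<oplus> y [^] p"
proof -
  \<comment> \<open>A double successor splits off both extreme terms of the binomial sum; all other
    coefficients are divisible by \<open>p\<close>.\<close>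
  obtain m where m: "p = Suc (Suc m)"
    using prime_ge_2_nat[OF p] by (metis Suc_le_D numeral_2_eq_2 Suc_le_mono)
  let ?t = "\<lambda>k. [(p choose k)] \<cdot> (x [^] k \<otimes> y [^] (p - k))"
  have t0: "?t (Suc k) = \<zero>" if "k \<le> m" for k
  proof -
    have "p dvd (p choose Suc k)"
      using that m by (intro dvd_choose_prime) (use p in auto)
    then obtain d where "p choose Suc k = d * p"
      by (metis dvd_div_mult_self)
    moreover have "[(d * p)] \<cdot> z = \<zero>" if "z \<in> carrier R" for z
      using add_pow_base_eq_zero[OF card add.nat_pow_closed[OF that]]
      by (simp add: add.nat_pow_pow that)
    ultimately show ?thesis
      using x y by (metis m_closed nat_pow_closed)
  qed
  have "(x \<oplus> y) [^] p = (\<Oplus>k\<in>{..Suc (Suc m)}. ?t k)"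
    using binomial_expansion[OF x y, of p] m by simp
  also have "\<dots> = ?t p \<oplus> ((\<Oplus>k\<in>{..m}. ?t (Suc k)) \<oplus> ?t 0)"
    using x y m by (subst finsum_Suc, force, subst finsum_Suc2) auto
  also have "(\<Oplus>k\<in>{..m}. ?t (Suc k)) = (\<Oplus>k\<in>{..m}. \<zero>)"
    using t0 by (intro finsum_cong') auto
  finally show ?thesis
    using x y by simp
qed

lemma (in domain) frobenius_add:
  assumes q: "primepow q" and card: "card (carrier R) = q ^ M"
    and x: "x \<in> carrier R" and y: "y \<in> carrier R"
  shows "(x \<oplus> y) [^] (q ^ j) = x [^] (q ^ j) \<oplus> y [^] (q ^ j)"
proof -
  obtain p k where p: "Factorial_Ring.prime p" and qp: "q = p ^ k"
    using q by (auto simp: primepow_def)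
  have "(x \<oplus> y) [^] (p ^ l) = x [^] (p ^ l) \<oplus> y [^] (p ^ l)" for l
  proof (induction l)
    case (Suc l)
    have step: "z [^] (p ^ Suc l) = (z [^] (p ^ l)) [^] p" if "z \<in> carrier R" for z
      using that by (simp add: nat_pow_pow mult.commute)
    show ?case
      using x y Suc prime_pow_add[OF p, of "k * M"] card qp by (simp only: step a_closed) (simp add: power_mult)
  qed (use x y in simp)
  then show ?thesis
    unfolding qp by (metis power_mult)
qed

section \<open>Subfields as fixed points of Frobenius powers\<close>

lemma (in domain) pow_pred_eq_one:
  assumes "x \<in> carrier R" "x \<noteq> \<zero>" "x [^] m = x" "m > 0"
  shows "x [^] (m - 1 :: nat) = \<one>"
proof -
  obtain d where d: "m = Suc d"
    using assms(4) gr0_implies_Suc by blast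
  then have "x [^] d \<otimes> x = \<one> \<otimes> x"
    using assms by simp
  then show ?thesis
    using assms d by (metis diff_Suc_1 m_rcancel nat_pow_closed one_closed)
qed

text \<open>One inclusion is Lagrange's theorem in the unit group of \<open>K\<close>; the other is
  a count, since \<open>X ^ (card K - 1) - 1\<close> has at most \<open>card K - 1\<close> roots.
  Membership in a subfield thus becomes an equation between powers.\<close>

lemma (in field) subfield_eq_fixed_points:
  assumes fin: "finite (carrier R)" and K: "subfield K R"
  shows "K = {x \<in> carrier R. x [^] card K = x}"
proof (rule card_seteq)
  note Kp = subringE[OF subfieldE(1)[OF K]]
  have finK: "finite K"
    using fin Kp(1) finite_subset by blast
  have "card {\<zero>, \<one>} \<le> card K"
    using Kp(2,3) finK by (intro card_mono) auto
  then have card2: "card K \<ge> 2" by simp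
  show "K \<subseteq> {x \<in> carrier R. x [^] card K = x}"
  proof
    fix x assume x: "x \<in> K"
    then have xc: "x \<in> carrier R" using Kp(1) by auto
    have "x [^] card K = x"
    proof (cases "x = \<zero>")
      case True
      then show ?thesis using card2 by (simp add: nat_pow_zero)
    next
      case False
      interpret K: field "R\<lparr>carrier := K\<rparr>" by (rule subfield_iff(2)[OF K])
      interpret M: group "Multiplicative_Group.mult_of (R\<lparr>carrier := K\<rparr>)" by (rule K.field_mult_group)
      have "x [^]\<^bsub>Multiplicative_Group.mult_of (R\<lparr>carrier := K\<rparr>)\<^esub> (card K - 1) = \<one>"
        using M.pow_order_eq_1[of x] x False finK Kp(2) by (simp add: order_def)
      then have "x [^] (card K - 1) = \<one>"
        by (simp add: nat_pow_mult_of nat_pow_def)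
      then have "x [^] Suc (card K - 1) = x"
        using xc by simp
      then show ?thesis using card2 by simp
    qed
    with xc show "x \<in> {x \<in> carrier R. x [^] card K = x}" by simp
  qed
  have "{x \<in> carrier R. x [^] card K = x} \<subseteq> insert \<zero> {x \<in> carrier R. x [^] (card K - 1) = \<one>}"
    using pow_pred_eq_one card2 by auto
  then have "card {x \<in> carrier R. x [^] card K = x}
      \<le> card (insert \<zero> {x \<in> carrier R. x [^] (card K - 1) = \<one>})"
    using fin by (intro card_mono) auto
  also have "\<dots> \<le> Suc (card {x \<in> carrier R. x [^] (card K - 1) = \<one>})"
    by (rule card_insert_le_m1[OF zero_less_Suc, simplified]) simp
  also have "\<dots> \<le> Suc (card K - 1)"
    using num_roots_le_deg[OF fin, of "card K - 1"] card2 by simp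
  finally show "card {x \<in> carrier R. x [^] card K = x} \<le> card K"
    using card2 by simp
  show "finite {x \<in> carrier R. x [^] card K = x}" using fin by simp
qed

lemma (in field) mem_subfield_iff:
  assumes "finite (carrier R)" "subfield K R"
  shows "x \<in> K \<longleftrightarrow> x \<in> carrier R \<and> x [^] card K = x"
  using subfield_eq_fixed_points[OF assms] by blast

section \<open>Dimension and cardinality\<close>

text \<open>Adjoining a vector \<open>v\<close> outside \<open>E\<close> multiplies the size by
  \<open>card K\<close>: two representations with different coefficients of \<open>v\<close> would,
  after division, put \<open>v\<close> into \<open>E\<close>.\<close>

lemma (in ring) card_dimension:
  assumes K: "subfield K R" and fin: "finite (carrier R)" and "dimension d K E"
  shows "card E = card K ^ d"
  using assms(3) K
proof (induction rule: dimension.induct)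
  case (zero_dim K)
  then show ?case by simp
next
  case (Suc_dim v E n K)
  note K = \<open>subfield K R\<close>
  note Ep = space_subgroup_props[OF K Suc_dim(3)]
  note Kp = subringE[OF subfieldE(1)[OF K]]
  let ?f = "\<lambda>(k, u). k \<otimes> v \<oplus> u"
  have "inj_on ?f (K \<times> E)"
  proof (rule inj_onI, clarify)
    fix k u k' u' assume h: "k \<in> K" "u \<in> E" "k' \<in> K" "u' \<in> E" "k \<otimes> v \<oplus> u = k' \<otimes> v \<oplus> u'"
    then have c: "k \<in> carrier R" "k' \<in> carrier R" "u \<in> carrier R" "u' \<in> carrier R" "v \<in> carrier R"
      using Kp(1) Ep(1) Suc_dim(1) by auto
    have eq: "(k \<ominus> k') \<otimes> v = u' \<ominus> u"
    proof -
      have "(k \<ominus> k') \<otimes> v = (k \<otimes> v \<oplus> u) \<ominus> (k' \<otimes> v \<oplus> u)"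
        using c by algebra
      also have "\<dots> = u' \<ominus> u"
        unfolding h(5) using c by algebra
      finally show ?thesis .
    qed
    have "k \<ominus> k' = \<zero>"
    proof (rule ccontr)
      assume "k \<ominus> k' \<noteq> \<zero>"
      then have "k \<ominus> k' \<in> K - {\<zero>}"
        using h Kp(5,7) by (simp add: a_minus_def)
      moreover have "u' \<ominus> u \<in> E" using h Ep(3,4) by (simp add: a_minus_def)
      ultimately have "v \<in> E" using eq Ep(6)[of "k \<ominus> k'" v] c by simp
      then show False using Suc_dim(2) by simp
    qed
    then have "k = k'" using c by simp
    with h c show "k = k' \<and> u = u'" by simp
  qed
  moreover have "line_extension K v E = ?f ` (K \<times> E)"
    by (force simp: line_extension_mem_iff)
  ultimately show ?case
    using Suc_dim by (simp add: card_image card_cartesian_product)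
qed

text \<open>A finite subspace spans itself, so it has some dimension \<open>m\<close>, and its size
  determines \<open>m\<close> because \<open>card K \<ge> 2\<close>.\<close>

lemma (in ring) dimension_if_card:
  assumes K: "subfield K R" and fin: "finite (carrier R)" and E: "subalgebra K E R"
    and card: "card E = card K ^ d"
  shows "dimension d K E"
proof -
  note Kp = subringE[OF subfieldE(1)[OF K]]
  have Ec: "E \<subseteq> carrier R" by (rule subalgebra_in_carrier[OF E])
  obtain Us where Us: "set Us = E"
    using finite_list finite_subset[OF Ec fin] by blast
  have "Span K Us = E"
    using subalgebra_Span_incl[OF K E] Span_base_incl[OF K] Us Ec by auto
  then obtain m where m: "dimension m K E"
    using Span_finite_dimension[OF K, of Us] Us Ec by auto
  have "card {\<zero>, \<one>} \<le> card K"
    using Kp(1,2,3) fin by (intro card_mono) (auto intro: finite_subset)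
  then have "card K \<ge> 2" using subfieldE(6)[OF K] by auto
  moreover have "card K ^ m = card K ^ d"
    using card_dimension[OF K fin m] card by simp
  ultimately have "m = d" by (simp add: power_inject_exp)
  with m show ?thesis by simp
qed


section \<open>Coordinates over a subfield\<close>

lemma (in ring) pow_mem_subring:
  assumes "subring K R" "x \<in> K"
  shows "x [^] (m::nat) \<in> K"
  using subringE(3,6)[OF assms(1)] assms(2) by (induction m) auto

lemma (in ring) minus_mem_subring:
  assumes "subring K R" "x \<in> K" "y \<in> K"
  shows "x \<ominus> y \<in> K"
  using subringE(5,7)[OF assms(1)] assms by (simp add: a_minus_def)

text \<open>If \<open>v \<noteq> v'\<close>, then \<open>w\<close> would be a quotient of elements
  of \<open>K\<close>. Applied to \<open>1, \<omega>\<close> over the field of order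
  \<open>q ^ n\<close> and also over the field of order \<open>q ^ (3 * n)\<close>.\<close>

lemma (in ring) subfield_coordinates_unique:
  assumes K: "subfield K R" and w: "w \<in> carrier R" "w \<notin> K"
    and k: "u \<in> K" "v \<in> K" "u' \<in> K" "v' \<in> K"
    and eq: "u \<oplus> v \<otimes> w = u' \<oplus> v' \<otimes> w"
  shows "u = u'" "v = v'"
proof -
  note S = subfieldE(1)[OF K]
  have c: "u \<in> carrier R" "v \<in> carrier R" "u' \<in> carrier R" "v' \<in> carrier R"
    using k subringE(1)[OF S] by auto
  have "(v \<ominus> v') \<otimes> w = (u \<oplus> v \<otimes> w) \<ominus> (u \<oplus> v' \<otimes> w)"
    using c w by algebra
  also have "\<dots> = u' \<ominus> u"
    unfolding eq using c w by algebra
  finally have "(v \<ominus> v') \<otimes> w \<in> K"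
    using minus_mem_subring[OF S] k by simp
  then have "v \<ominus> v' = \<zero>"
    using subfield_m_inv_simprule[OF K, of "v \<ominus> v'" w] w minus_mem_subring[OF S] k by blast
  then show "v = v'" using c by simp
  with eq show "u = u'" using c w by simp
qed

text \<open>Uniqueness of coordinates embeds \<open>K \<times> K\<close> into \<open>M\<close>, and
  both have the same size.\<close>

lemma (in ring) quadratic_extension_eq:
  assumes fin: "finite M" and K: "subfield K R" and M: "subfield M R" and KM: "K \<subseteq> M"
    and card: "card M = card K ^ 2" and w: "w \<in> M - K"
  shows "M = {u \<oplus> v \<otimes> w | u v. u \<in> K \<and> v \<in> K}"
proof -
  let ?f = "\<lambda>(u, v). u \<oplus> v \<otimes> w"
  note Mp = subringE[OF subfieldE(1)[OF M]]
  have "w \<in> carrier R" using w Mp(1) by auto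
  then have "inj_on ?f (K \<times> K)"
    using subfield_coordinates_unique[OF K] w by (auto intro!: inj_onI)
  then have "card (?f ` (K \<times> K)) = card M"
    using card by (simp add: card_image card_cartesian_product power2_eq_square)
  moreover have "?f ` (K \<times> K) \<subseteq> M"
    using KM w by (auto intro!: Mp(6,7))
  ultimately have "?f ` (K \<times> K) = M"
    using fin by (simp add: card_subset_eq)
  then show ?thesis by auto
qed

section \<open>Arithmetic of Frobenius and norm exponents\<close>

lemma (in monoid) frobenius_fixed_mult:
  assumes "x \<in> carrier G" "x [^] ((q::nat) ^ j) = x"
  shows "x [^] (q ^ (j * k)) = x"
  using assms by (induction k) (simp_all add: power_add nat_pow_pow[symmetric])

lemma (in monoid) frobenius_fixed_gcd:
  assumes x: "x \<in> carrier G" and fixed: "x [^] ((q::nat) ^ i) = x" "x [^] (q ^ n) = x" and "i \<noteq> 0"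
  shows "x [^] (q ^ gcd i n) = x"
proof -
  \<comment> \<open>Bezout with natural coefficients: the exponents \<open>i * s\<close> and
    \<open>n * t\<close> both fix \<open>x\<close>, so their difference does too.\<close>
  obtain s t where "i * s = n * t + gcd i n"
    using bezout_nat[OF \<open>i \<noteq> 0\<close>] by blast
  then have "x [^] (q ^ (i * s)) = (x [^] (q ^ (n * t))) [^] (q ^ gcd i n)"
    using x by (simp add: nat_pow_pow power_add)
  then show ?thesis
    using x fixed by (simp only: frobenius_fixed_mult)
qed

lemma (in comm_monoid) finprod_conjugates:
  assumes "x \<in> carrier G"
  shows "(\<Otimes>j\<in>{..<m}. x [^] ((q::nat) ^ j)) = x [^] (\<Sum>j<m. q ^ j)"
  using assms by (induction m) (simp_all add: lessThan_Suc nat_pow_mult add.commute)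

text \<open>\<open>E\<close> is the exponent with \<open>a ^ E = N(a) ^ ((q - 1) / 3)\<close>. The
  geometric sum gives the first claim. For the second, \<open>P = q ^ n\<close> is 1 modulo 3, so 3
  divides the factor \<open>P ^ 2 + P + 1\<close> of \<open>P ^ 3 - 1\<close>.\<close>

lemma norm_exponent:
  fixes q n :: nat
  assumes "[q = 1] (mod 3)"
  defines "E \<equiv> (\<Sum>j<3 * n. q ^ j) * ((q - 1) div 3)"
  shows "3 * E = (q ^ n) ^ 3 - 1" and "(q ^ n - 1) dvd E"
proof -
  have q: "q \<ge> 1" "q mod 3 = 1"
    using assms(1) by (auto simp: cong_def intro: Nat.gr0I)
  have geo: "(\<Sum>j<m. q ^ j) * (q - 1) = q ^ m - 1" for m
  proof -
    have "int ((\<Sum>j<m. q ^ j) * (q - 1)) = int (q ^ m) - 1"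
      using q(1) by (simp add: of_nat_diff power_diff_1_eq mult.commute)
    then show ?thesis by linarith
  qed
  have "3 * ((q - 1) div 3) = q - 1"
    using q by presburger
  then have "3 * E = (\<Sum>j<3 * n. q ^ j) * (q - 1)"
    unfolding E_def by (metis mult.left_commute)
  then show E3: "3 * E = (q ^ n) ^ 3 - 1"
    unfolding geo by (simp add: power_mult[symmetric] mult.commute)
  define P where "P = q ^ n"
  have P: "P \<ge> 1" "[P = 1] (mod 3)"
    using q(1) cong_pow[OF assms(1), of n] by (simp_all add: P_def)
  then have "[P ^ 2 + P + 1 = 1 ^ 2 + 1 + 1] (mod 3)"
    by (intro cong_add cong_pow cong_refl)
  then have "3 dvd P ^ 2 + P + 1"
    by (simp add: cong_def dvd_eq_mod_eq_0)
  then obtain d where d: "P ^ 2 + P + 1 = 3 * d" ..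
  have "int (P ^ 3 - 1) = int ((P - 1) * (P ^ 2 + P + 1))"
    using P(1) by (simp add: of_nat_diff algebra_simps power2_eq_square power3_eq_cube)
  then have "P ^ 3 - 1 = (P - 1) * (P ^ 2 + P + 1)"
    by (simp only: of_nat_eq_iff)
  then have "3 * E = 3 * ((P - 1) * d)"
    using E3 unfolding d P_def[symmetric] by simp
  then show "(q ^ n - 1) dvd E"
    by (simp add: P_def)
qed

section \<open>The plane invariant under the semilinear map\<close>

text \<open>Multiplication by \<open>a\<close> scales the two conjugate columns of the determinant
  \<open>c\<close> by different factors, \<open>a ^ P\<close> and
  \<open>a ^ (P ^ 2)\<close>.\<close>

lemma (in cring) det_scale:
  assumes "s \<in> carrier R" "t \<in> carrier R" "u \<in> carrier R" "v \<in> carrier R" "y \<in> carrier R" "z \<in> carrier R"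
  shows "(u \<otimes> z \<ominus> y \<otimes> v) \<otimes> (s \<otimes> t) = (s \<otimes> u) \<otimes> (t \<otimes> z) \<ominus> (s \<otimes> y) \<otimes> (t \<otimes> v)"
  using assms by algebra

text \<open>\<open>-r\<close> is the determinant of the substitution taking \<open>(w, x)\<close> to
  \<open>(p w + r x, w)\<close>.\<close>

lemma (in cring) det_transvect:
  assumes "p \<in> carrier R" "r \<in> carrier R" "u \<in> carrier R" "v \<in> carrier R" "y \<in> carrier R" "z \<in> carrier R"
  shows "(p \<otimes> u \<oplus> r \<otimes> y) \<otimes> v \<ominus> u \<otimes> (p \<otimes> v \<oplus> r \<otimes> z) = (\<ominus> r) \<otimes> (u \<otimes> z \<ominus> y \<otimes> v)"
  using assms by algebra

text \<open>The map \<open>z \<mapsto> a z ^ Q\<close> takes \<open>x\<close> to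
  \<open>w = a x ^ Q\<close>, and \<open>inv\<close> gives the image of \<open>w\<close>, so the
  span of \<open>x\<close> and \<open>w\<close> over \<open>K\<close> is invariant. The exponent
  \<open>3 * E\<close> kills the units of \<open>M\<close>, while \<open>E\<close> kills those of
  \<open>K\<close> and all \<open>(Q - 1)\<close>-th powers of units of \<open>M\<close>.\<close>

lemma (in field) semilinear_invariant_plane:
  fixes P Q E :: nat
  assumes fin: "finite (carrier R)"
    and K: "subfield K R" "card K = P" and M: "subfield M R" "card M = P ^ 3"
    and addP: "\<And>u v. u \<in> carrier R \<Longrightarrow> v \<in> carrier R \<Longrightarrow> (u \<oplus> v) [^] P = u [^] P \<oplus> v [^] P"
    and addQ: "\<And>u v. u \<in> carrier R \<Longrightarrow> v \<in> carrier R \<Longrightarrow> (u \<oplus> v) [^] Q = u [^] Q \<oplus> v [^] Q"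
    and mod3: "[P = 1] (mod 3)" "[Q = 1] (mod 3)"
    and E: "3 * E = P ^ 3 - 1" "(P - 1) dvd E"
    and a: "a \<in> M" "a \<noteq> \<zero>" and x: "x \<in> M" "x \<noteq> \<zero>"
    and p: "p \<in> K" and r: "r \<in> K" "r \<noteq> \<zero>"
    and inv: "a \<otimes> (a \<otimes> x [^] Q) [^] Q = p \<otimes> (a \<otimes> x [^] Q) \<oplus> r \<otimes> x"
  shows "a [^] E = \<one>"
proof -
  note SK = subfieldE(1)[OF K(1)] and SM = subfieldE(1)[OF M(1)]
  note Kc = subringE(1)[OF SK] and Mc = subringE(1)[OF SM]
  have ac: "a \<in> carrier R" and xc: "x \<in> carrier R" and pc: "p \<in> carrier R" and rc: "r \<in> carrier R"
    using a x p r Kc Mc by auto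
  have PQ: "P \<ge> 1" "P mod 3 = 1" "Q \<ge> 1" "Q mod 3 = 1"
    using mod3 by (auto simp: cong_def intro: Nat.gr0I)
  have M3: "z [^] (3 * E) = \<one>" if "z \<in> M" "z \<noteq> \<zero>" for z
  proof -
    have "z [^] (P ^ 3) = z"
      using mem_subfield_iff[OF fin M(1)] M(2) that by auto
    then show ?thesis
      using pow_pred_eq_one[of z "P ^ 3"] E(1) that Mc PQ(1) by auto
  qed
  \<comment> \<open>Since 3 divides \<open>Q - 1\<close>, such a power is a power of a cube.\<close>
  have MQ: "(z [^] (Q - 1)) [^] E = \<one>" if "z \<in> M" "z \<noteq> \<zero>" for z
  proof -
    have "3 dvd Q - 1"
      using PQ(3,4) by presburger
    then obtain d where "Q - 1 = 3 * d" ..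
    then have "(z [^] (Q - 1)) [^] E = (z [^] (3 * E)) [^] d"
      using that Mc by (simp add: nat_pow_pow subset_iff ac_simps)
    with M3[OF that] show ?thesis by simp
  qed
  have K1: "z [^] E = \<one>" if "z \<in> carrier R" "z [^] P = z" "z \<noteq> \<zero>" for z
  proof -
    obtain d where "E = (P - 1) * d" using E(2) ..
    with pow_pred_eq_one[of z P] that PQ(1) show ?thesis
      by (simp add: nat_pow_pow[symmetric])
  qed
  have KP: "z [^] P = z" if "z \<in> K" for z
    using mem_subfield_iff[OF fin K(1)] K(2) that by auto
  have xQ: "x [^] Q = x [^] (Q - 1) \<otimes> x"
    using PQ(3) xc by (metis Suc_diff_1 nat_pow_Suc less_eq_Suc_le One_nat_def)
  define w where "w = a \<otimes> x [^] Q"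
  have wM: "w \<in> M"
    unfolding w_def using a x subringE(6)[OF SM] pow_mem_subring[OF SM] by simp
  then have wc: "w \<in> carrier R" using Mc by auto
  \<comment> \<open>The determinant whose columns are the \<open>P\<close>-th and
    \<open>P ^ 2\<close>-th powers of \<open>(w, x)\<close>. Conjugation fixes \<open>p\<close> and
    \<open>r\<close>, so both columns obey the relation \<open>inv\<close> with the same
    coefficients.\<close>
  define c where "c = w [^] P \<otimes> x [^] (P * P) \<ominus> x [^] P \<otimes> w [^] (P * P)"
  have cM: "c \<in> M"
    unfolding c_def using wM x subringE(6)[OF SM] pow_mem_subring[OF SM] minus_mem_subring[OF SM]
    by simp
  then have cc: "c \<in> carrier R" using Mc by auto
  show ?thesis
  proof (cases "c = \<zero>")
    case True
    \<comment> \<open>\<open>g\<close> is the quotient of \<open>w\<close> by \<open>x\<close>; it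
      turns out to be fixed by the \<open>P\<close>-th power.\<close>
    define g where "g = a \<otimes> x [^] (Q - 1)"
    have gc: "g \<in> carrier R" and g0: "g \<noteq> \<zero>"
      using ac xc a x nat_pow_nonzero by (auto simp: g_def integral_iff)
    have wg: "w = g \<otimes> x"
      using ac xc by (simp add: w_def g_def xQ m_assoc)
    have "g [^] P \<otimes> (x [^] P \<otimes> x [^] (P * P)) = g [^] (P * P) \<otimes> (x [^] P \<otimes> x [^] (P * P))"
    proof -
      have "w [^] P \<otimes> x [^] (P * P) = x [^] P \<otimes> w [^] (P * P)"
        using True unfolding c_def using wc xc by simp
      then show ?thesis
        unfolding wg using gc xc by (simp add: nat_pow_distrib m_ac)
    qed
    then have gP: "g [^] P = g [^] (P * P)"
      using gc xc nat_pow_nonzero x(2) by (subst (asm) m_rcancel) (auto simp: integral_iff)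
    have gM: "g \<in> M"
      unfolding g_def using a x subringE(6)[OF SM] pow_mem_subring[OF SM] by simp
    then have g3: "g [^] (P * P * P) = g"
      using mem_subfield_iff[OF fin M(1)] M(2) by (auto simp: power3_eq_cube)
    \<comment> \<open>Raising \<open>g ^ P = g ^ (P ^ 2)\<close> to the power \<open>P ^ 2\<close>
      gives \<open>g\<close> on the left and \<open>g ^ P\<close> on the right.\<close>
    have "g [^] (P * P * P) = (g [^] P) [^] (P * P)"
      using gc by (simp add: nat_pow_pow ac_simps)
    also have "\<dots> = (g [^] (P * P)) [^] (P * P)"
      using gP by simp
    also have "\<dots> = (g [^] (P * P * P)) [^] P"
      using gc by (simp add: nat_pow_pow ac_simps)
    finally have "g [^] P = g" using g3 by simp
    then have "g [^] E = \<one>" using K1 gc g0 by simp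
    \<comment> \<open>\<open>g ^ E\<close> is \<open>a ^ E\<close> times the \<open>E\<close>-th
      power of \<open>x ^ (Q - 1)\<close>, which is 1.\<close>
    then show ?thesis
      using MQ[OF x] ac xc by (simp add: g_def nat_pow_distrib)
  next
    case False
    \<comment> \<open>Additivity for \<open>(u \<ominus> v) \<oplus> v\<close> avoids evaluating the
      sign \<open>(-1) ^ Q\<close>.\<close>
    have subQ: "(u \<ominus> v) [^] Q = u [^] Q \<ominus> v [^] Q" if "u \<in> carrier R" "v \<in> carrier R" for u v
    proof -
      have "u [^] Q = (u \<ominus> v) [^] Q \<oplus> v [^] Q"
        using addQ[of "u \<ominus> v" v] that by (simp add: a_minus_def a_assoc l_neg)
      moreover have "s \<oplus> t \<ominus> t = s" if "s \<in> carrier R" "t \<in> carrier R" for s t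
        using that by algebra
      ultimately show ?thesis using that by simp
    qed
    have invP: "(a \<otimes> w [^] Q) [^] P = p \<otimes> w [^] P \<oplus> r \<otimes> x [^] P"
      using inv[folded w_def] addP wc xc pc rc KP[OF p] KP[OF r(1)] by (simp add: nat_pow_distrib)
    have invPP: "(a \<otimes> w [^] Q) [^] (P * P) = p \<otimes> w [^] (P * P) \<oplus> r \<otimes> x [^] (P * P)"
    proof -
      have "(a \<otimes> w [^] Q) [^] (P * P) = ((a \<otimes> w [^] Q) [^] P) [^] P"
        using ac wc by (simp add: nat_pow_pow)
      also have "\<dots> = p \<otimes> w [^] (P * P) \<oplus> r \<otimes> x [^] (P * P)"
        unfolding invP using addP wc xc pc rc KP[OF p] KP[OF r(1)]
        by (simp add: nat_pow_distrib nat_pow_pow)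
      finally show ?thesis .
    qed
    \<comment> \<open>Both sides are the determinant of the image pair, which the conjugated
      relations then evaluate as \<open>-r\<close> times \<open>c\<close>.\<close>
    have "c [^] Q \<otimes> (a [^] P \<otimes> a [^] (P * P))
        = (a \<otimes> w [^] Q) [^] P \<otimes> (a \<otimes> x [^] Q) [^] (P * P)
          \<ominus> (a \<otimes> x [^] Q) [^] P \<otimes> (a \<otimes> w [^] Q) [^] (P * P)"
    proof -
      have pw: "(z [^] m) [^] Q = (z [^] Q) [^] m" if "z \<in> carrier R" for z and m :: nat
        using that by (simp add: nat_pow_pow mult.commute)
      have c: "c [^] Q = (w [^] Q) [^] P \<otimes> (x [^] Q) [^] (P * P) \<ominus> (x [^] Q) [^] P \<otimes> (w [^] Q) [^] (P * P)"
        unfolding c_def using wc xc by (simp add: subQ nat_pow_distrib pw)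
      have d: "(a \<otimes> z [^] Q) [^] m = a [^] m \<otimes> (z [^] Q) [^] m" if "z \<in> carrier R" for z and m :: nat
        using that ac by (simp add: nat_pow_distrib)
      have "a [^] P \<in> carrier R" "a [^] (P * P) \<in> carrier R" "(w [^] Q) [^] P \<in> carrier R"
        "(w [^] Q) [^] (P * P) \<in> carrier R" "(x [^] Q) [^] P \<in> carrier R" "(x [^] Q) [^] (P * P) \<in> carrier R"
        using ac wc xc by simp_all
      then show ?thesis
        unfolding c d[OF wc] d[OF xc] by (rule det_scale)
    qed
    also have "\<dots> = (p \<otimes> w [^] P \<oplus> r \<otimes> x [^] P) \<otimes> w [^] (P * P)
          \<ominus> w [^] P \<otimes> (p \<otimes> w [^] (P * P) \<oplus> r \<otimes> x [^] (P * P))"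
      unfolding invP invPP w_def[symmetric] ..
    also have "\<dots> = (\<ominus> r) \<otimes> c"
    proof -
      have "w [^] P \<in> carrier R" "w [^] (P * P) \<in> carrier R" "x [^] P \<in> carrier R" "x [^] (P * P) \<in> carrier R"
        using wc xc by simp_all
      then show ?thesis
        unfolding c_def using pc rc by (intro det_transvect)
    qed
    finally have main: "c [^] Q \<otimes> (a [^] P \<otimes> a [^] (P * P)) = (\<ominus> r) \<otimes> c" .
    have cQ: "c [^] Q = c [^] (Q - 1) \<otimes> c"
      using PQ(3) cc by (metis Suc_diff_1 nat_pow_Suc less_eq_Suc_le One_nat_def)
    have "(c [^] (Q - 1) \<otimes> a [^] (P + P * P)) \<otimes> c = (\<ominus> r) \<otimes> c"
      using main ac cc unfolding cQ by (simp add: nat_pow_mult[symmetric] m_ac)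
    then have eq: "c [^] (Q - 1) \<otimes> a [^] (P + P * P) = \<ominus> r"
      using ac cc rc False by (subst (asm) m_rcancel) auto
    \<comment> \<open>\<open>-r\<close> lies in \<open>K\<close>, and \<open>E\<close> kills
      \<open>c ^ (Q - 1)\<close>, so only the power of \<open>a\<close> remains.\<close>
    have "(\<ominus> r) [^] E = \<one>"
      using K1 KP[of "\<ominus> r"] subringE(5)[OF SK r(1)] r(2) rc by auto
    then have "(a [^] (P + P * P)) [^] E = \<one>"
      unfolding eq[symmetric] using MQ[OF cM False] ac cc by (simp add: nat_pow_distrib)
    \<comment> \<open>As \<open>P\<close> is 1 modulo 3, the exponent is 2 modulo 3; the multiple of
      3 is absorbed by \<open>a ^ (3 E) = 1\<close>.\<close>
    moreover obtain d where d: "P + P * P = 3 * d + 2"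
    proof -
      have "[P + P * P = 1 + 1 * 1] (mod 3)"
        using mod3(1) by (intro cong_add cong_mult)
      then have "(P + P * P) mod 3 = 2" by (simp add: cong_def)
      then have "P + P * P = 3 * ((P + P * P) div 3) + 2"
        by (metis mult_div_mod_eq)
      then show ?thesis by (rule that)
    qed
    ultimately have "a [^] ((3 * d + 2) * E) = \<one>"
      using ac unfolding d by (simp only: nat_pow_pow)
    moreover have "(3 * d + 2) * E = 3 * E * d + 2 * E"
      by (simp add: algebra_simps)
    ultimately have "a [^] (3 * E * d + 2 * E) = \<one>"
      by metis
    then have "(a [^] (3 * E)) [^] d \<otimes> a [^] (2 * E) = \<one>"
      using ac by (simp add: nat_pow_pow nat_pow_mult)
    then have "a [^] (2 * E) = \<one>"
      using M3[OF a] ac by simp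
    moreover have "a [^] (3 * E) = a [^] (2 * E) \<otimes> a [^] E"
      using ac by (simp add: nat_pow_mult)
    ultimately show ?thesis
      using M3[OF a] ac by simp
  qed
qed

section \<open>Vectors of \<open>U\<close> on the same point\<close>

lemma (in ring) Span_singleton:
  assumes "K \<subseteq> carrier R" "v \<in> carrier R"
  shows "Span K [v] = {k \<otimes> v | k. k \<in> K}"
  using assms by (auto simp: line_extension_mem_iff subset_iff)

text \<open>This is scatteredness in terms of the scalar \<open>l\<close>. Coordinates with respect
  to \<open>1, w\<close> are compared over \<open>T\<close>, where \<open>w \<notin> T\<close> keeps
  them unique, while those of \<open>l\<close> and \<open>w \<otimes> w\<close> lie already in
  \<open>K\<close>.\<close>

lemma (in field) same_point_imp_mem_base_field:
  fixes q n i :: nat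
  assumes q: "primepow q" and q3: "[q = 1] (mod 3)"
    and fin: "finite (carrier R)" and card: "card (carrier R) = q ^ N"
    and Fq: "subfield Fq R" "card Fq = q" and K: "subfield K R" "card K = q ^ n"
    and M: "subfield M R" "card M = q ^ (2 * n)" and T: "subfield T R" "card T = q ^ (3 * n)"
    and w: "w \<in> M" "w \<notin> K" "w \<notin> T" and KM: "K \<subseteq> M" and KT: "K \<subseteq> T"
    and a: "a \<in> T" "a \<noteq> \<zero>" and i: "i \<noteq> 0" "gcd i n = 1"
    and norm: "a [^] ((\<Sum>j<3 * n. q ^ j) * ((q - 1) div 3)) \<noteq> \<one>"
    and l: "l \<in> M" and x: "x \<in> T" "x \<noteq> \<zero>" and y: "y \<in> T"
    and eq: "l \<otimes> (a \<otimes> x [^] (q ^ i) \<oplus> x \<otimes> w) = a \<otimes> y [^] (q ^ i) \<oplus> y \<otimes> w"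
  shows "l \<in> Fq"
proof -
  note SK = subfieldE(1)[OF K(1)] and SM = subfieldE(1)[OF M(1)] and ST = subfieldE(1)[OF T(1)]
  note Kc = subringE(1)[OF SK] and Mc = subringE(1)[OF SM] and Tc = subringE(1)[OF ST]
  let ?Q = "q ^ i"
  have wc: "w \<in> carrier R" using w Mc by auto
  have Mrep: "M = {u \<oplus> v \<otimes> w | u v. u \<in> K \<and> v \<in> K}"
    using quadratic_extension_eq[OF finite_subset[OF Mc fin] K(1) M(1) KM] K(2) M(2) w
    by (simp add: power_mult[symmetric] mult.commute)
  obtain \<alpha> \<beta> where \<alpha>\<beta>: "\<alpha> \<in> K" "\<beta> \<in> K" and l_eq: "l = \<alpha> \<oplus> \<beta> \<otimes> w"
    using l unfolding Mrep by blast
  have "w \<otimes> w \<in> M" using w subringE(6)[OF SM] by simp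
  \<comment> \<open>The quadratic equation of \<open>w\<close> over \<open>K\<close> removes
    \<open>w \<otimes> w\<close> from the product below.\<close>
  then obtain B A where AB: "B \<in> K" "A \<in> K" and ww: "w \<otimes> w = B \<oplus> A \<otimes> w"
    unfolding Mrep by blast
  have kc: "\<alpha> \<in> carrier R" "\<beta> \<in> carrier R" "A \<in> carrier R" "B \<in> carrier R"
    using \<alpha>\<beta> AB Kc by auto
  have kT: "\<alpha> \<in> T" "\<beta> \<in> T" "A \<in> T" "B \<in> T"
    using \<alpha>\<beta> AB KT by auto
  have c: "a \<in> carrier R" "x \<in> carrier R" "y \<in> carrier R"
    using a x y Tc by auto
  define z where "z = a \<otimes> x [^] ?Q"
  \<comment> \<open>The coefficient of \<open>x\<close> in the \<open>w\<close>-coordinate of the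
    product.\<close>
  define \<delta> where "\<delta> = \<alpha> \<oplus> \<beta> \<otimes> A"
  have zT: "z \<in> T"
    unfolding z_def using a x pow_mem_subring[OF ST] subringE(6)[OF ST] by simp
  have zc: "z \<in> carrier R" using zT Tc by auto
  have \<delta>K: "\<delta> \<in> K"
    unfolding \<delta>_def using \<alpha>\<beta> AB subringE(6,7)[OF SK] by simp
  have \<delta>c: "\<delta> \<in> carrier R" and \<delta>T: "\<delta> \<in> T" using \<delta>K Kc KT by auto
  have "l \<otimes> (z \<oplus> x \<otimes> w) = (\<alpha> \<otimes> z \<oplus> \<beta> \<otimes> z \<otimes> w \<oplus> \<alpha> \<otimes> x \<otimes> w) \<oplus> \<beta> \<otimes> x \<otimes> (w \<otimes> w)"
    unfolding l_eq using kc zc c wc by algebra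
  also have "\<dots> = (\<alpha> \<otimes> z \<oplus> \<beta> \<otimes> B \<otimes> x) \<oplus> (\<beta> \<otimes> z \<oplus> \<delta> \<otimes> x) \<otimes> w"
    unfolding ww \<delta>_def using kc zc c wc by algebra
  finally have "a \<otimes> y [^] ?Q \<oplus> y \<otimes> w = (\<alpha> \<otimes> z \<oplus> \<beta> \<otimes> B \<otimes> x) \<oplus> (\<beta> \<otimes> z \<oplus> \<delta> \<otimes> x) \<otimes> w"
    using eq unfolding z_def by simp
  moreover have "a \<otimes> y [^] ?Q \<in> T" "\<alpha> \<otimes> z \<oplus> \<beta> \<otimes> B \<otimes> x \<in> T" "\<beta> \<otimes> z \<oplus> \<delta> \<otimes> x \<in> T"
    using a x y kT zT \<delta>T pow_mem_subring[OF ST] by (auto intro!: subringE(6,7)[OF ST])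
  ultimately have ayQ: "a \<otimes> y [^] ?Q = \<alpha> \<otimes> z \<oplus> \<beta> \<otimes> B \<otimes> x" and y_eq: "y = \<beta> \<otimes> z \<oplus> \<delta> \<otimes> x"
    using subfield_coordinates_unique[OF T(1) wc w(3)] y by metis+
  note add = frobenius_add[OF q card]
  show ?thesis
  proof (cases "\<beta> = \<zero>")
    case True
    then have "y = \<alpha> \<otimes> x" and "a \<otimes> y [^] ?Q = \<alpha> \<otimes> z"
      using y_eq ayQ kc zc c by (simp_all add: \<delta>_def)
    \<comment> \<open>Inserting \<open>y = \<alpha> x\<close> into \<open>a y ^ Q\<close> shows
      \<open>\<alpha> ^ Q = \<alpha>\<close>; as \<open>\<alpha>\<close> lies in \<open>K\<close>
      and \<open>gcd i n = 1\<close>, it is fixed by the \<open>q\<close>-th power.\<close>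
    then have "\<alpha> [^] ?Q \<otimes> z = \<alpha> \<otimes> z"
      using c kc by (simp add: z_def nat_pow_distrib m_ac)
    moreover have "z \<noteq> \<zero>"
      using c a x nat_pow_nonzero by (auto simp: z_def integral_iff)
    ultimately have "\<alpha> [^] ?Q = \<alpha>"
      using kc zc m_rcancel by (metis nat_pow_closed)
    moreover have "\<alpha> [^] (q ^ n) = \<alpha>"
      using mem_subfield_iff[OF fin K(1)] K(2) \<alpha>\<beta>(1) by simp
    ultimately have "\<alpha> [^] q = \<alpha>"
      using frobenius_fixed_gcd[of \<alpha> q i n] kc i by simp
    then have "\<alpha> \<in> Fq"
      using mem_subfield_iff[OF fin Fq(1)] Fq(2) kc by simp
    then show ?thesis
      using l_eq True kc wc by simp
  next
    case False
    \<comment> \<open>Up to sign, \<open>B\<close> is the norm of \<open>w\<close> over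
      \<open>K\<close>. It is a factor of the coefficient \<open>r\<close> of the invariance
      relation.\<close>
    have "B \<noteq> \<zero>"
    proof
      assume "B = \<zero>"
      then have "w \<otimes> w = A \<otimes> w" using ww kc wc by simp
      moreover have "w \<noteq> \<zero>" using w(2) subringE(2)[OF SK] by auto
      ultimately have "w = A" using kc wc m_rcancel by metis
      then show False using w(2) AB by simp
    qed
    define b where "b = inv (\<beta> [^] ?Q)"
    have \<beta>Q: "\<beta> [^] ?Q \<in> K - {\<zero>}"
      using pow_mem_subring[OF SK \<alpha>\<beta>(2)] nat_pow_nonzero[OF kc(2) False] by simp
    have b: "b \<in> K" "b \<noteq> \<zero>" "b \<otimes> \<beta> [^] ?Q = \<one>"
      using subfield_m_inv[OF K(1) \<beta>Q] by (auto simp: b_def)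
    have bc: "b \<in> carrier R" using b Kc by auto
    \<comment> \<open>Two values of \<open>a y ^ Q\<close>: on the left \<open>y\<close> comes from
      the \<open>w\<close>-coordinate, with \<open>a x ^ Q = z\<close>; on the right stands the
      other coordinate.\<close>
    have "\<beta> [^] ?Q \<otimes> (a \<otimes> z [^] ?Q) \<oplus> \<delta> [^] ?Q \<otimes> z = \<alpha> \<otimes> z \<oplus> \<beta> \<otimes> B \<otimes> x"
    proof -
      have "a \<otimes> y [^] ?Q = a \<otimes> (\<beta> [^] ?Q \<otimes> z [^] ?Q \<oplus> \<delta> [^] ?Q \<otimes> x [^] ?Q)"
        unfolding y_eq using kc zc \<delta>c c by (simp add: add nat_pow_distrib)
      also have "\<dots> = \<beta> [^] ?Q \<otimes> (a \<otimes> z [^] ?Q) \<oplus> \<delta> [^] ?Q \<otimes> z"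
        unfolding z_def using kc \<delta>c c by (simp add: r_distr m_ac)
      finally show ?thesis using ayQ by simp
    qed
    moreover have solve: "a' = b \<otimes> (\<alpha> \<ominus> d) \<otimes> z \<oplus> b \<otimes> \<beta> \<otimes> B \<otimes> x"
      if "e \<otimes> a' \<oplus> d \<otimes> z = \<alpha> \<otimes> z \<oplus> \<beta> \<otimes> B \<otimes> x" "b \<otimes> e = \<one>"
        "e \<in> carrier R" "a' \<in> carrier R" "d \<in> carrier R" for e a' d
    proof -
      have "a' = (b \<otimes> e) \<otimes> a'" using that by simp
      also have "\<dots> = b \<otimes> ((e \<otimes> a' \<oplus> d \<otimes> z) \<ominus> d \<otimes> z)"
        using that(3-5) bc zc by algebra
      also have "\<dots> = b \<otimes> (\<alpha> \<ominus> d) \<otimes> z \<oplus> b \<otimes> \<beta> \<otimes> B \<otimes> x"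
        unfolding that(1) using that(3-5) kc bc zc c by algebra
      finally show ?thesis .
    qed
    ultimately have inv: "a \<otimes> z [^] ?Q = b \<otimes> (\<alpha> \<ominus> \<delta> [^] ?Q) \<otimes> z \<oplus> b \<otimes> \<beta> \<otimes> B \<otimes> x"
      using b(3) kc c zc \<delta>c by (intro solve[of "\<beta> [^] ?Q"]) simp_all
    \<comment> \<open>These are the coefficients \<open>p\<close> and \<open>r\<close> for the
      invariant plane.\<close>
    have "b \<otimes> (\<alpha> \<ominus> \<delta> [^] ?Q) \<in> K" "b \<otimes> \<beta> \<otimes> B \<in> K"
      using \<alpha>\<beta> AB b \<delta>K pow_mem_subring[OF SK] minus_mem_subring[OF SK]
      by (auto intro!: subringE(6)[OF SK])
    moreover have "b \<otimes> \<beta> \<otimes> B \<noteq> \<zero>"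
      using b False \<open>B \<noteq> \<zero>\<close> bc kc by (simp add: integral_iff)
    moreover have "card T = (q ^ n) ^ 3"
      using T(2) by (simp add: power_mult[symmetric] mult.commute)
    moreover have "[q ^ m = 1] (mod 3)" for m
      using cong_pow[OF q3, of m] by simp
    ultimately have "a [^] ((\<Sum>j<3 * n. q ^ j) * ((q - 1) div 3)) = \<one>"
      using semilinear_invariant_plane[OF fin K T(1) _ add add _ _ norm_exponent[OF q3] a x _ _ _
          inv[unfolded z_def]] by blast
    with norm show ?thesis by simp
  qed
qed

section \<open>Rank and scatteredness of the linear set\<close>

theorem theorem2p4:
  fixes F :: "('a, 'b) ring_scheme"
    and Fq Fqn Fq2n Fq3n U :: "'a set"
    and L :: "'a set set"
    and \<omega> a :: 'a
    and q n i :: nat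
  assumes "primepow q" and "[q = 1] (mod 3)" and "n \<ge> 2"
    and "field F" and "finite (carrier F)" and "card (carrier F) = q ^ (6 * n)"
    and "subfield Fq F" and "card Fq = q"
    and "subfield Fqn F" and "card Fqn = q ^ n"
    and "subfield Fq2n F" and "card Fq2n = q ^ (2 * n)"
    and "subfield Fq3n F" and "card Fq3n = q ^ (3 * n)"
    and "\<omega> \<in> Fq2n - Fqn"
    and "a \<in> Fq3n - {\<zero>\<^bsub>F\<^esub>}"
    and "1 \<le> i" and "i \<le> 3 * n - 1"
    and "gcd i (2 * n) = 1" and "gcd i (3 * n) = 1"
    and "finite_field_norm F q (3 * n) a [^]\<^bsub>F\<^esub> ((q - 1) div 3) \<noteq> \<one>\<^bsub>F\<^esub>"
    and U: "U = {a \<otimes>\<^bsub>F\<^esub> x [^]\<^bsub>F\<^esub> (q ^ i) \<oplus>\<^bsub>F\<^esub> x \<otimes>\<^bsub>F\<^esub> \<omega> | x. x \<in> Fq3n}"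
    and L: "L = {ring.Span F Fq2n [a \<otimes>\<^bsub>F\<^esub> x [^]\<^bsub>F\<^esub> (q ^ i) \<oplus>\<^bsub>F\<^esub> x \<otimes>\<^bsub>F\<^esub> \<omega>] | x.
                  x \<in> Fq3n - {\<zero>\<^bsub>F\<^esub>}}"
  shows "ring.dimension F 3 Fq2n (carrier F)
       \<and> linear_set_of_rank F Fq Fq2n (3 * n) U L
       \<and> scattered_linear_set F Fq Fq2n U"
proof -
  interpret field F by fact
  note fin = \<open>finite (carrier F)\<close> and card = \<open>card (carrier F) = q ^ (6 * n)\<close>
  note Fq = \<open>subfield Fq F\<close> \<open>card Fq = q\<close> and K = \<open>subfield Fqn F\<close> \<open>card Fqn = q ^ n\<close>
    and M = \<open>subfield Fq2n F\<close> \<open>card Fq2n = q ^ (2 * n)\<close>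
    and T = \<open>subfield Fq3n F\<close> \<open>card Fq3n = q ^ (3 * n)\<close>
  note mem = mem_subfield_iff[OF fin]
  note ST = subfieldE(1)[OF T(1)]
  note Fqc = subfieldE(3)[OF Fq(1)] and Mc = subfieldE(3)[OF M(1)] and Tc = subfieldE(3)[OF T(1)]
  note add = frobenius_add[OF \<open>primepow q\<close> card]
  have a: "a \<in> Fq3n" "a \<noteq> \<zero>\<^bsub>F\<^esub>" and ac: "a \<in> carrier F"
    using \<open>a \<in> Fq3n - {\<zero>\<^bsub>F\<^esub>}\<close> Tc by auto
  have w: "\<omega> \<in> Fq2n" "\<omega> \<notin> Fqn" and wc: "\<omega> \<in> carrier F"
    using \<open>\<omega> \<in> Fq2n - Fqn\<close> Mc by auto
  \<comment> \<open>A fixed point of a Frobenius power is fixed by its iterates, so divisibility of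
    degrees yields the inclusions of subfields.\<close>
  have KM: "Fqn \<subseteq> Fq2n"
    using frobenius_fixed_mult[of _ q n 2] by (auto simp: mem[OF K(1)] mem[OF M(1)] K(2) M(2) mult.commute)
  have KT: "Fqn \<subseteq> Fq3n"
    using frobenius_fixed_mult[of _ q n 3] by (auto simp: mem[OF K(1)] mem[OF T(1)] K(2) T(2) mult.commute)
  have FqT: "Fq \<subseteq> Fq3n"
    using frobenius_fixed_mult[of _ q 1 "3 * n"] by (auto simp: mem[OF Fq(1)] mem[OF T(1)] Fq(2) T(2))
  have FqM: "Fq \<subseteq> Fq2n"
    using frobenius_fixed_mult[of _ q 1 "2 * n"] by (auto simp: mem[OF Fq(1)] mem[OF M(1)] Fq(2) M(2))
  \<comment> \<open>The fields of order \<open>q ^ (2 * n)\<close> and \<open>q ^ (3 * n)\<close>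
    meet in the one of order \<open>q ^ n\<close>.\<close>
  have wT: "\<omega> \<notin> Fq3n"
  proof
    assume "\<omega> \<in> Fq3n"
    then have "\<omega> [^]\<^bsub>F\<^esub> (q ^ (2 * n + n)) = \<omega>"
      by (simp add: mem[OF T(1)] T(2))
    moreover have "\<omega> [^]\<^bsub>F\<^esub> (q ^ (2 * n)) = \<omega>"
      using w(1) by (simp add: mem[OF M(1)] M(2))
    ultimately have "\<omega> [^]\<^bsub>F\<^esub> (q ^ n) = \<omega>"
      using wc by (simp only: power_add nat_pow_pow[symmetric])
    then show False
      using w(2) wc by (simp add: mem[OF K(1)] K(2))
  qed
  \<comment> \<open>A bijection from \<open>Fq3n\<close> onto \<open>U\<close>, linear over
    \<open>Fq\<close>; it yields the rank by counting.\<close>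
  define f where "f = (\<lambda>x. a \<otimes>\<^bsub>F\<^esub> x [^]\<^bsub>F\<^esub> (q ^ i) \<oplus>\<^bsub>F\<^esub> x \<otimes>\<^bsub>F\<^esub> \<omega>)"
  have Uf: "U = f ` Fq3n" unfolding U f_def by auto
  have fc: "f x \<in> carrier F" if "x \<in> Fq3n" for x
    unfolding f_def using that ac wc Tc by auto
  have finj: "inj_on f Fq3n"
  proof (rule inj_onI)
    fix x y assume xy: "x \<in> Fq3n" "y \<in> Fq3n" "f x = f y"
    \<comment> \<open>The \<open>\<omega>\<close>-coordinate of \<open>f x\<close> over
      \<open>Fq3n\<close> is \<open>x\<close> itself.\<close>
    then show "x = y"
      unfolding f_def using subfield_coordinates_unique(2)[OF T(1) wc wT _ xy(1) _ xy(2)] a(1)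
        pow_mem_subring[OF ST] subringE(6)[OF ST] by meson
  qed
  \<comment> \<open>This keeps the exponent \<open>q ^ i\<close> positive; \<open>\<zero>\<close> to
    the power 0 would be \<open>\<one>\<close>.\<close>
  have qpos: "q > 0" using \<open>primepow q\<close> primepow_gt_0_nat by blast
  have f0: "f \<zero>\<^bsub>F\<^esub> = \<zero>\<^bsub>F\<^esub>"
    unfolding f_def using ac wc qpos by (simp add: nat_pow_zero)
  have fz: "f x = \<zero>\<^bsub>F\<^esub> \<longleftrightarrow> x = \<zero>\<^bsub>F\<^esub>" if "x \<in> Fq3n" for x
    using finj f0 that subringE(2)[OF ST] by (metis inj_onD)
  have fadd: "f (x \<oplus>\<^bsub>F\<^esub> y) = f x \<oplus>\<^bsub>F\<^esub> f y" if "x \<in> Fq3n" "y \<in> Fq3n" for x y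
  proof -
    have "x \<in> carrier F" "y \<in> carrier F" using that Tc by auto
    then show ?thesis
      unfolding f_def using ac wc by (simp add: add r_distr l_distr a_ac)
  qed
  have fsmult: "f (k \<otimes>\<^bsub>F\<^esub> x) = k \<otimes>\<^bsub>F\<^esub> f x" if "k \<in> Fq" "x \<in> Fq3n" for k x
  proof -
    have c: "k \<in> carrier F" "x \<in> carrier F" using that Tc Fqc by auto
    moreover have "k [^]\<^bsub>F\<^esub> (q ^ i) = k"
      using frobenius_fixed_mult[of k q 1 i] that(1) by (simp add: mem[OF Fq(1)] Fq(2))
    ultimately show ?thesis
      unfolding f_def using ac wc by (simp add: nat_pow_distrib r_distr m_ac)
  qed
  have Usub: "subalgebra Fq U F"
  proof (intro subalgebra.intro add.subgroupI)
    show "U \<subseteq> carrier F" unfolding Uf using fc by auto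
    show "U \<noteq> {}" unfolding Uf using a(1) by auto
    show "\<ominus>\<^bsub>F\<^esub> u \<in> U" if u: "u \<in> U" for u
    proof -
      obtain x where x: "x \<in> Fq3n" "u = f x" using u unfolding Uf by auto
      have "f (\<ominus>\<^bsub>F\<^esub> x) \<oplus>\<^bsub>F\<^esub> f x = \<zero>\<^bsub>F\<^esub>"
        using fadd[of "\<ominus>\<^bsub>F\<^esub> x" x] x subringE(5)[OF ST] Tc f0 by (auto simp: l_neg)
      then have "\<ominus>\<^bsub>F\<^esub> u = f (\<ominus>\<^bsub>F\<^esub> x)"
        using x fc subringE(5)[OF ST] minus_equality by simp
      then show ?thesis unfolding Uf using x subringE(5)[OF ST] by simp
    qed
    show "u \<oplus>\<^bsub>F\<^esub> v \<in> U" if "u \<in> U" "v \<in> U" for u v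
      using that subringE(7)[OF ST] unfolding Uf by (auto simp: fadd[symmetric])
    show "subalgebra_axioms Fq U F"
      unfolding Uf using subringE(6)[OF ST] FqT
      by (intro subalgebra_axioms.intro) (auto simp: fsmult[symmetric])
  qed
  have "card U = card Fq ^ (3 * n)"
    unfolding Uf using finj by (simp add: card_image T(2) Fq(2))
  then have Udim: "dimension (3 * n) Fq U"
    by (rule dimension_if_card[OF Fq(1) fin Usub])
  have Lf: "L = {Span Fq2n [f x] | x. x \<in> Fq3n - {\<zero>\<^bsub>F\<^esub>}}"
    unfolding L f_def ..
  then have L_eq: "L = linear_set F Fq2n U"
    unfolding linear_set_def Uf using fz by (auto simp del: Span.simps)
  have LPG: "L \<subseteq> PG_points F Fq2n"
    unfolding Lf PG_points_def using fc fz by (auto simp del: Span.simps)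
  have "card (carrier F) = card Fq2n ^ 3"
    using card M(2) by (simp add: power_mult[symmetric])
  then have dim3: "dimension 3 Fq2n (carrier F)"
    by (rule dimension_if_card[OF M(1) fin carrier_is_subalgebra[OF Mc]])
  \<comment> \<open>The product of the conjugates is one power of \<open>a\<close>, with a geometric
    sum as exponent.\<close>
  have norm: "a [^]\<^bsub>F\<^esub> ((\<Sum>j<3 * n. q ^ j) * ((q - 1) div 3)) \<noteq> \<one>\<^bsub>F\<^esub>"
    using assms(21) ac unfolding finite_field_norm_def
    by (simp add: finprod_conjugates nat_pow_pow)
  have "gcd i n = 1"
    using \<open>gcd i (3 * n) = 1\<close> by (metis coprime_iff_gcd_eq_1 coprime_mult_right_iff)
  note core = same_point_imp_mem_base_field[OF \<open>primepow q\<close> \<open>[q = 1] (mod 3)\<close> fin card Fq K M T w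
      wT KM KT a _ this norm]
  have "dimension 1 Fq (U \<inter> P)" if P: "P \<in> linear_set F Fq2n U" for P
  proof -
    obtain x where x: "x \<in> Fq3n" "x \<noteq> \<zero>\<^bsub>F\<^esub>" and P: "P = Span Fq2n [f x]"
      using P fz unfolding linear_set_def Uf by auto
    have fxc: "f x \<in> carrier F" using fc x by simp
    \<comment> \<open>A scalar carrying \<open>f x\<close> into \<open>U\<close> lies in
      \<open>Fq\<close>; conversely, \<open>Fq\<close>-multiples stay in \<open>U\<close> by
      linearity of \<open>f\<close>.\<close>
    have "U \<inter> P = Span Fq [f x]"
    proof
      show "U \<inter> P \<subseteq> Span Fq [f x]"
      proof
        fix u assume "u \<in> U \<inter> P"
        then obtain y k where "y \<in> Fq3n" "k \<in> Fq2n" "u = f y" "u = k \<otimes>\<^bsub>F\<^esub> f x"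
          unfolding P Uf Span_singleton[OF Mc fxc] by auto
        moreover from this have "k \<in> Fq"
          using core[of k x y] x \<open>1 \<le> i\<close> unfolding f_def by simp
        ultimately show "u \<in> Span Fq [f x]"
          unfolding Span_singleton[OF Fqc fxc] by blast
      qed
      show "Span Fq [f x] \<subseteq> U \<inter> P"
        unfolding P Uf Span_singleton[OF Mc fxc] Span_singleton[OF Fqc fxc]
        using FqM FqT x subringE(6)[OF ST] by (auto simp: fsmult[symmetric])
    qed
    moreover have "independent Fq [f x]"
      using fxc fz x by (intro li_Cons) auto
    ultimately show ?thesis
      using dimension_independent[of Fq "[f x]"] by simp
  qed
  then show ?thesis
    using dim3 Usub Udim L_eq LPG
    by (simp add: linear_set_of_rank_def scattered_linear_set_def)
qed

end
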